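(* Let $\pi=\prod_{j=1}^{m}t_{k_{j}}^{i_{k_{j}}}$ ($m\ge1$) be a standard OGS elementary element of $S_{n}$ presented in the standard OGS canonical form, with $i_{k_j}>0$ for every $1\le j\le m$ (so $maj(\pi)\leq k_1<k_2<\cdots<k_m$). For $1\le j\le m$ let $\rho_{j}=\sum_{x=j}^m i_{k_x}$, $\varrho_{j}=\sum_{x=1}^j i_{k_x}$, $\vartheta_{j}=k_j-\rho_1$, with $\varrho_0=\rho_{m+1}=0$, and put $\kappa_{-;j}=\varrho_{j-1}+\vartheta_{j}=k_{j}-\rho_{j}$, $\kappa_{+;j}=\varrho_{j}+\vartheta_{j}=k_{j}-\rho_{j+1}$. Then $$\pi^{-1}=t_{\kappa_{+;1}}^{\vartheta_{1}}\cdot (t_{\kappa_{-;2}}^{\varrho_{1}}\cdot t_{\kappa_{+;2}}^{\vartheta_{2}})\cdot (t_{\kappa_{-;3}}^{\varrho_{2}}\cdot t_{\kappa_{+;3}}^{\vartheta_{3}})\cdots (t_{\kappa_{-;m}}^{\varrho_{m-1}}\cdot t_{\kappa_{+;m}}^{\vartheta_{m}}).$$ In the specific case $k_{1}=\rho_{1}=maj(\pi)$ one has $\kappa_{-;1}=\vartheta_{1}=0$, and thus $$\pi^{-1}=(t_{\kappa_{-;2}}^{\varrho_{1}}\cdot t_{\kappa_{+;2}}^{\vartheta_{2}})\cdot (t_{\kappa_{-;3}}^{\varrho_{2}}\cdot t_{\kappa_{+;3}}^{\vartheta_{3}})\cdots (t_{\kappa_{-;m}}^{\varrho_{m-1}}\cdot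 t_{\kappa_{+;m}}^{\vartheta_{m}}).$$ Therefore $$des(\pi^{-1})=\begin{cases}\{\kappa_{-;j} : 1\leq j\leq m\} & \text{if } k_{1}>maj(\pi), \\ \{\kappa_{-;j} : 2\leq j\leq m\} & \text{if } k_{1}=maj(\pi).\end{cases}$$
   Context: $S_n$ is the group of permutations of $\{1,\dots,n\}$, with products taken from left to right: $(\pi_1\cdot\pi_2)(i)=\pi_2(\pi_1(i))$. $s_i$ is the transposition $(i,i+1)$. $des(\pi)=\{1\le i\le n-1: \pi(i)>\pi(i+1)\}$ and $maj(\pi)=\sum_{i\in des(\pi)}i$. For $2\le m\le n$, $t_m=s_1s_2\cdots s_{m-1}$; put $t_1=1$. Every element of $S_n$ has a unique presentation $t_2^{i_2}t_3^{i_3}\cdots t_n^{i_n}$ with $0\le i_k<k$ (the standard OGS canonical form); one often writes only the factors with non-zero exponent. By a theorem of Adin and Roichman, $maj(\pi)$ equals the sum of the exponents in this form. An element $\prod_{j=1}^m t_{k_j}^{i_{k_j}}$ in this form, with $k_1<\cdots<k_m$ and $0<i_{k_j}<k_j$, is a standard OGS elementary element if $\sum_{j=1}^m i_{k_j}\le k_1$. *)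

theory Defs
  imports "HOL-Combinatorics.Permutations"
begin

text \<open>
  Elements of the symmetric group on \<open>{1..n}\<close> are functions \<open>p\<close> with \<open>p permutes {1..n}\<close>.
  Products are read from left to right, i.e. opposite to functional composition; powers
  (\<open>^^\<close>) and inverses (\<open>inv\<close>) do not depend on this convention.
\<close>

definition perm_mult :: "(nat \<Rightarrow> nat) \<Rightarrow> (nat \<Rightarrow> nat) \<Rightarrow> nat \<Rightarrow> nat"  (infixl \<open>\<cdot>\<close> 70)
  where "p \<cdot> q = q \<circ> p"

text \<open>\<open>perm_prod f a b\<close> is \<open>f a \<cdot> f (a + 1) \<cdot> \<dots> \<cdot> f b\<close>, and the identity if \<open>b < a\<close>.\<close>

definition perm_prod :: "(nat \<Rightarrow> nat \<Rightarrow> nat) \<Rightarrow> nat \<Rightarrow> nat \<Rightarrow> nat \<Rightarrow> nat"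
  where "perm_prod f a b = foldr (\<cdot>) (map f [a..<Suc b]) id"

definition s :: "nat \<Rightarrow> nat \<Rightarrow> nat"
  where "s i = transpose i (i + 1)"

definition t :: "nat \<Rightarrow> nat \<Rightarrow> nat"
  where "t m = perm_prod s 1 (m - 1)"

definition des :: "nat \<Rightarrow> (nat \<Rightarrow> nat) \<Rightarrow> nat set"
  where "des n p = {i. 1 \<le> i \<and> i \<le> n - 1 \<and> p i > p (i + 1)}"

definition maj :: "nat \<Rightarrow> (nat \<Rightarrow> nat) \<Rightarrow> nat"
  where "maj n p = (\<Sum>i\<in>des n p. i)"

text \<open>
  A standard OGS canonical form, restricted to its factors with non-zero exponent, is given by
  the number \<open>m\<close> of these factors, their indices \<open>k 1 < \<dots> < k m\<close> and a function \<open>i\<close> such that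
  \<open>i (k j)\<close> is the exponent of \<open>t (k j)\<close>. Values of \<open>k\<close> outside \<open>{1..m}\<close> and of \<open>i\<close> outside
  \<open>k ` {1..m}\<close> are irrelevant.
\<close>

definition OGS_canonical :: "nat \<Rightarrow> nat \<Rightarrow> (nat \<Rightarrow> nat) \<Rightarrow> (nat \<Rightarrow> nat) \<Rightarrow> bool"
  where "OGS_canonical n m k i \<longleftrightarrow>
    strict_mono_on {1..m} k \<and>
    (\<forall>j\<in>{1..m}. 2 \<le> k j \<and> k j \<le> n \<and> 0 < i (k j) \<and> i (k j) < k j)"

definition OGS_elementary :: "nat \<Rightarrow> nat \<Rightarrow> (nat \<Rightarrow> nat) \<Rightarrow> (nat \<Rightarrow> nat) \<Rightarrow> bool"
  where "OGS_elementary n m k i \<longleftrightarrow>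
    OGS_canonical n m k i \<and> (\<Sum>j=1..m. i (k j)) \<le> k 1"

definition OGS_rho :: "nat \<Rightarrow> (nat \<Rightarrow> nat) \<Rightarrow> (nat \<Rightarrow> nat) \<Rightarrow> nat \<Rightarrow> nat"
  where "OGS_rho m k i j = (\<Sum>x=j..m. i (k x))"

definition OGS_varrho :: "(nat \<Rightarrow> nat) \<Rightarrow> (nat \<Rightarrow> nat) \<Rightarrow> nat \<Rightarrow> nat"
  where "OGS_varrho k i j = (\<Sum>x=1..j. i (k x))"

text \<open>
  The subtraction below does not truncate for elementary forms and \<open>1 \<le> j \<le> m\<close>, since then
  \<open>OGS_rho m k i 1 \<le> k 1 \<le> k j\<close>.
\<close>

definition OGS_vartheta :: "nat \<Rightarrow> (nat \<Rightarrow> nat) \<Rightarrow> (nat \<Rightarrow> nat) \<Rightarrow> nat \<Rightarrow> nat"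
  where "OGS_vartheta m k i j = k j - OGS_rho m k i 1"

definition kappa_minus :: "nat \<Rightarrow> (nat \<Rightarrow> nat) \<Rightarrow> (nat \<Rightarrow> nat) \<Rightarrow> nat \<Rightarrow> nat"
  where "kappa_minus m k i j = OGS_varrho k i (j - 1) + OGS_vartheta m k i j"

definition kappa_plus :: "nat \<Rightarrow> (nat \<Rightarrow> nat) \<Rightarrow> (nat \<Rightarrow> nat) \<Rightarrow> nat \<Rightarrow> nat"
  where "kappa_plus m k i j = OGS_varrho k i j + OGS_vartheta m k i j"

end

theory Submission
  imports Defs
begin

text \<open>
  The powers of \<open>t m\<close> are the rotations of \<open>{1..m}\<close>: \<open>t (a + b) ^^ a\<close> exchanges the first \<open>a\<close>
  points with the \<open>b\<close> points behind them, keeping the order inside both parts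
  (\<open>t_power_apply\<close>). Put \<open>r j = \<varrho>\<^sub>j\<close>, \<open>\<theta> j = \<vartheta>\<^sub>j\<close> and \<open>\<theta> 0 = 0\<close>, so that \<open>k\<^sub>j = r m + \<theta> j\<close>. The
  inequality \<open>\<rho>\<^sub>1 \<le> k\<^sub>1\<close> says that, when the factors of \<open>\<pi>\<close> are applied one after the other, the
  \<open>j\<close>th of them lifts the points of \<open>{r (j - 1)<..r j}\<close> to the top of \<open>{1..k\<^sub>j}\<close>, and no point is
  lifted twice. Hence \<open>\<pi>\<close> adds \<open>\<theta> j\<close> on this \<open>j\<close>th block, and
  moves every point above \<open>r m\<close> down by the total length of the blocks that have overtaken it
  (\<open>elementary_apply\<close>). So \<open>\<pi>\<close> is increasing on \<open>{1..r m}\<close> and on \<open>{r m<..n}\<close>, and \<open>r m = \<rho>\<^sub>1\<close>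
  is its only descent and its major index.

  Reading the image from bottom to top, one meets alternately a gap of \<open>\<theta> j - \<theta> (j - 1)\<close> points
  that come from above \<open>r m\<close>, and the \<open>j\<close>th block. These are the steps of a staircase whose
  corners are \<open>\<kappa>\<^sub>-\<^sub>j = r (j - 1) + \<theta> j\<close>, where the \<open>j\<close>th block starts, and \<open>\<kappa>\<^sub>+\<^sub>j = r j + \<theta> j\<close>,
  where it ends. The \<open>j\<close>th pair of rotations in the formula for \<open>\<pi>\<inverse>\<close> cancels except that it
  exchanges the part \<open>{r (j - 1)<..\<kappa>\<^sub>-\<^sub>j}\<close> with the block \<open>{\<kappa>\<^sub>-\<^sub>j<..\<kappa>\<^sub>+\<^sub>j}\<close> (for \<open>j = 1\<close> the first
  rotation has exponent \<open>r 0 = 0\<close>, so it does not show in the formula): it brings this block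
  back to its source and moves all earlier gaps, together with the new one, up by the length of
  the block (\<open>rotation_pair_apply\<close>). So the product of these pairs sorts the blocks below the
  gaps (\<open>inverse_product_apply\<close>), which inverts \<open>\<pi>\<close>. It descends exactly where a nonempty gap is
  followed by a block, that is, at those \<open>\<kappa>\<^sub>-\<^sub>j\<close> for which \<open>\<theta> (j - 1) < \<theta> j\<close>; since \<open>\<theta>\<close> increases
  strictly from \<open>1\<close> on, only \<open>j = 1\<close> can fail, namely when \<open>\<theta> 1 = k\<^sub>1 - \<rho>\<^sub>1 = 0\<close>.
\<close>

section \<open>Products and powers of the generators\<close>

lemma perm_mult_apply [simp]: "(p \<cdot> q) x = q (p x)"
  by (simp add: perm_mult_def)

lemma perm_mult_id [simp]: "id \<cdot> p = p" "p \<cdot> id = p"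
  by (simp_all add: perm_mult_def)

lemma perm_prod_empty: "b < a \<Longrightarrow> perm_prod f a b = id"
  by (simp add: perm_prod_def)

lemma foldr_perm_mult: "foldr (\<cdot>) ps q = foldr (\<cdot>) ps id \<cdot> q"
  by (induction ps) (auto simp: perm_mult_def)

lemma perm_prod_Suc: "a \<le> Suc b \<Longrightarrow> perm_prod f a (Suc b) = perm_prod f a b \<cdot> f (Suc b)"
  by (simp add: perm_prod_def foldr_perm_mult[of _ "f (Suc b)"])

lemma perm_prod_first: "a \<le> b \<Longrightarrow> perm_prod f a b = f a \<cdot> perm_prod f (Suc a) b"
  by (simp add: perm_prod_def upt_conv_Cons del: upt_Suc)

lemma perm_prod_cong:
  "(\<And>j. a \<le> j \<Longrightarrow> j \<le> b \<Longrightarrow> f j = g j) \<Longrightarrow> perm_prod f a b = perm_prod g a b"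
  unfolding perm_prod_def by (rule arg_cong[where f = "\<lambda>ps. foldr (\<cdot>) ps id"]) auto

lemma t_Suc: "1 \<le> m \<Longrightarrow> t (Suc m) = t m \<cdot> s m"
  by (cases m) (simp_all add: t_def perm_prod_Suc)

lemma t_apply: "t m x = (if x = 1 \<and> 1 \<le> m then m else if 2 \<le> x \<and> x \<le> m then x - 1 else x)"
proof (induction m)
  case 0
  then show ?case by (simp add: t_def perm_prod_empty)
next
  case (Suc m)
  show ?case
  proof (cases "m = 0")
    case True
    then show ?thesis by (simp add: t_def perm_prod_empty)
  next
    case False
    then show ?thesis
      using Suc by (auto simp: t_Suc s_def transpose_def)
  qed
qed

lemma t_power_apply:
  assumes "a \<le> m"
  shows "(t m ^^ a) x =
    (if 1 \<le> x \<and> x \<le> a then x + (m - a) else if a < x \<and> x \<le> m then x - a else x)"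
  using assms
proof (induction a)
  case 0
  then show ?case by simp
next
  case (Suc a)
  then show ?case by (auto simp: t_apply)
qed

text \<open>
  The initial \<open>a\<close> points are moved up by \<open>b\<close> and then back down. The \<open>b\<close> points behind them are
  moved to the bottom and then up again, but now past \<open>c \<ge> a\<close> points.
\<close>
lemma rotation_pair_apply:
  assumes "a \<le> c"
  shows "(t (a + b) ^^ a \<cdot> t (c + b) ^^ b) x =
    (if x \<le> a then x else if x \<le> a + b then x + (c - a) else if x \<le> c + b then x - b else x)"
  using assms by (auto simp: t_power_apply)

section \<open>Staircases\<close>

lemma mono_step_exists:
  fixes f :: "nat \<Rightarrow> nat"
  assumes "f 0 < x" "x \<le> f m"
  obtains l where "l < m" "f l < x" "x \<le> f (Suc l)"
proof -
  have "\<exists>l<m. f l < x \<and> x \<le> f (Suc l)"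
    using assms(2)
  proof (induction m)
    case 0
    then show ?case using assms(1) by simp
  next
    case (Suc m)
    then show ?case by (cases "x \<le> f m") (auto intro: less_SucI)
  qed
  then show thesis using that by blast
qed

text \<open>
  The block widths \<open>r (l + 1) - r l\<close> are positive, whereas the gap heights \<open>\<theta> (l + 1) - \<theta> l\<close> may
  vanish. The values \<open>r 0 = \<theta> 0 = 0\<close> make the bottom gap, of height \<open>k\<^sub>1 - \<rho>\<^sub>1\<close>, a gap like the
  others.
\<close>
locale staircase =
  fixes m :: nat and r \<theta> :: "nat \<Rightarrow> nat"
  assumes r_0: "r 0 = 0" and \<theta>_0: "\<theta> 0 = 0"
    and r_step: "l < m \<Longrightarrow> r l < r (Suc l)"
    and \<theta>_step: "l < m \<Longrightarrow> \<theta> l \<le> \<theta> (Suc l)"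
begin

lemma r_mono: "a \<le> b \<Longrightarrow> b \<le> m \<Longrightarrow> r a \<le> r b"
proof (induction b rule: dec_induct)
  case (step b)
  then show ?case using r_step[of b] by simp
qed simp

lemma \<theta>_mono: "a \<le> b \<Longrightarrow> b \<le> m \<Longrightarrow> \<theta> a \<le> \<theta> b"
proof (induction b rule: dec_induct)
  case (step b)
  then show ?case using \<theta>_step[of b] by simp
qed simp

lemma r_less: "a < b \<Longrightarrow> b \<le> m \<Longrightarrow> r a < r b"
  using r_step[of a] r_mono[of "Suc a" b] by simp

text \<open>
  The third clause keeps track of the points of \<open>{1..r m}\<close> that still wait to be lifted. They
  occupy the initial segment \<open>{1..r m - r j}\<close>, and the next factor lifts the first
  \<open>r (j + 1) - r j\<close> of them. All other points lie above this segment, so that this factor either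
  moves them down by \<open>r (j + 1) - r j\<close> or fixes them.
\<close>
lemma elementary_prefix_apply:
  fixes j :: nat
  defines "Q \<equiv> perm_prod (\<lambda>j. t (r m + \<theta> j) ^^ (r j - r (j - 1))) 1"
  assumes "j \<le> m"
  shows "(\<forall>l x. l < j \<longrightarrow> r l < x \<longrightarrow> x \<le> r (Suc l) \<longrightarrow> Q j x = x + \<theta> (Suc l) + (r m - r j)) \<and>
    (\<forall>l x. l < j \<longrightarrow> r m + \<theta> l < x \<longrightarrow> x \<le> r m + \<theta> (Suc l) \<longrightarrow> Q j x = x - (r j - r l)) \<and>
    (\<forall>x. r j < x \<longrightarrow> x \<le> r m \<longrightarrow> Q j x = x - r j) \<and>
    (\<forall>x. r m + \<theta> j < x \<longrightarrow> Q j x = x)"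
  using assms(2)
proof (induction j)
  case 0
  then show ?case by (simp add: Q_def perm_prod_empty r_0)
next
  case (Suc j)
  then have IH:
    "\<And>l x. \<lbrakk>l < j; r l < x; x \<le> r (Suc l)\<rbrakk> \<Longrightarrow> Q j x = x + \<theta> (Suc l) + (r m - r j)"
    "\<And>l x. \<lbrakk>l < j; r m + \<theta> l < x; x \<le> r m + \<theta> (Suc l)\<rbrakk> \<Longrightarrow> Q j x = x - (r j - r l)"
    "\<And>x. \<lbrakk>r j < x; x \<le> r m\<rbrakk> \<Longrightarrow> Q j x = x - r j"
    "\<And>x. r m + \<theta> j < x \<Longrightarrow> Q j x = x"
    by simp_all
  define d where "d = r (Suc j) - r j"
  have r: "r (Suc j) = r j + d" "r (Suc j) \<le> r m"
    using Suc.prems r_step[of j] r_mono[of "Suc j" m] by (simp_all add: d_def)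
  have \<theta>: "\<theta> j \<le> \<theta> (Suc j)"
    using Suc.prems \<theta>_step[of j] by simp
  have Q: "Q (Suc j) x = (t (r m + \<theta> (Suc j)) ^^ d) (Q j x)" for x
    by (simp add: Q_def d_def perm_prod_Suc)
  have rot: "(t (r m + \<theta> (Suc j)) ^^ d) z =
    (if 1 \<le> z \<and> z \<le> d then z + (r m + \<theta> (Suc j) - d)
     else if d < z \<and> z \<le> r m + \<theta> (Suc j) then z - d else z)" for z
    using r by (intro t_power_apply) simp
  show ?case
  proof (intro conjI allI impI)
    fix l x assume l: "l < Suc j" "r l < x" "x \<le> r (Suc l)"
    show "Q (Suc j) x = x + \<theta> (Suc l) + (r m - r (Suc j))"
    proof (cases "l = j")
      case True
      then show ?thesis using l r IH(3)[of x] by (simp add: Q rot, arith)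
    next
      case False
      then have "r (Suc l) \<le> r j" "\<theta> (Suc l) \<le> \<theta> j"
        using l Suc.prems r_mono[of "Suc l" j] \<theta>_mono[of "Suc l" j] by simp_all
      then show ?thesis using False l r \<theta> IH(1)[of l x] by (simp add: Q rot, arith)
    qed
  next
    fix l x assume l: "l < Suc j" "r m + \<theta> l < x" "x \<le> r m + \<theta> (Suc l)"
    show "Q (Suc j) x = x - (r (Suc j) - r l)"
    proof (cases "l = j")
      case True
      then show ?thesis using l r IH(4)[of x] by (simp add: Q rot)
    next
      case False
      then have "r l \<le> r j" "\<theta> (Suc l) \<le> \<theta> j"
        using l Suc.prems r_mono[of l j] \<theta>_mono[of "Suc l" j] by simp_all
      then show ?thesis using False l r \<theta> IH(2)[of l x] by (simp add: Q rot, arith)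
    qed
  next
    fix x assume "r (Suc j) < x" "x \<le> r m"
    then show "Q (Suc j) x = x - r (Suc j)"
      using r IH(3)[of x] by (simp add: Q rot, arith)
  next
    fix x assume "r m + \<theta> (Suc j) < x"
    then show "Q (Suc j) x = x"
      using r \<theta> IH(4)[of x] by (simp add: Q rot)
  qed
qed

definition elementary :: "nat \<Rightarrow> nat"
  where "elementary = perm_prod (\<lambda>j. t (r m + \<theta> j) ^^ (r j - r (j - 1))) 1 m"

lemma elementary_apply:
  shows elementary_block:
      "\<lbrakk>l < m; r l < x; x \<le> r (Suc l)\<rbrakk> \<Longrightarrow> elementary x = x + \<theta> (Suc l)"
    and elementary_gap:
      "\<lbrakk>l < m; r m + \<theta> l < x; x \<le> r m + \<theta> (Suc l)\<rbrakk> \<Longrightarrow> elementary x = x - (r m - r l)"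
    and elementary_above: "r m + \<theta> m < x \<Longrightarrow> elementary x = x"
  using elementary_prefix_apply[of m] unfolding elementary_def by auto

lemma elementary_0: "elementary 0 = 0"
proof -
  have "perm_prod (\<lambda>j. t (r m + \<theta> j) ^^ (r j - r (j - 1))) 1 j 0 = 0" if "j \<le> m" for j
    using that
  proof (induction j)
    case (Suc j)
    then show ?case
      using r_mono[of "Suc j" m] by (simp add: perm_prod_Suc t_power_apply)
  qed (simp add: perm_prod_empty)
  then show ?thesis by (simp add: elementary_def)
qed

text \<open>
  After \<open>j\<close> pairs of rotations the first \<open>j\<close> blocks are sorted into \<open>{1..r j}\<close>, which the later
  pairs fix, and the first \<open>j\<close> gaps follow directly, so that they belong to the part which the
  next pair shifts.
\<close>
lemma inverse_prefix_apply:
  fixes j :: nat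
  defines "P \<equiv> perm_prod (\<lambda>j. t (r (j - 1) + \<theta> j) ^^ r (j - 1) \<cdot> t (r j + \<theta> j) ^^ \<theta> j) 1"
  assumes "j \<le> m"
  shows "(\<forall>l y. l < j \<longrightarrow> r l + \<theta> (Suc l) < y \<longrightarrow> y \<le> r (Suc l) + \<theta> (Suc l) \<longrightarrow>
       P j y = y - \<theta> (Suc l)) \<and>
    (\<forall>l y. l < j \<longrightarrow> r l + \<theta> l < y \<longrightarrow> y \<le> r l + \<theta> (Suc l) \<longrightarrow> P j y = y + (r j - r l)) \<and>
    (\<forall>y. r j + \<theta> j < y \<longrightarrow> P j y = y) \<and> P j 0 = 0"
  using assms(2)
proof (induction j)
  case 0
  then show ?case by (simp add: P_def perm_prod_empty)
next
  case (Suc j)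
  then have IH:
    "\<And>l y. \<lbrakk>l < j; r l + \<theta> (Suc l) < y; y \<le> r (Suc l) + \<theta> (Suc l)\<rbrakk> \<Longrightarrow> P j y = y - \<theta> (Suc l)"
    "\<And>l y. \<lbrakk>l < j; r l + \<theta> l < y; y \<le> r l + \<theta> (Suc l)\<rbrakk> \<Longrightarrow> P j y = y + (r j - r l)"
    "\<And>y. r j + \<theta> j < y \<Longrightarrow> P j y = y"
    "P j 0 = 0"
    by simp_all
  have r: "r j < r (Suc j)" and \<theta>: "\<theta> j \<le> \<theta> (Suc j)"
    using Suc.prems r_step[of j] \<theta>_step[of j] by simp_all
  have P: "P (Suc j) y =
    (if P j y \<le> r j then P j y
     else if P j y \<le> r j + \<theta> (Suc j) then P j y + (r (Suc j) - r j)
     else if P j y \<le> r (Suc j) + \<theta> (Suc j) then P j y - \<theta> (Suc j) else P j y)" for y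
    using r rotation_pair_apply[of "r j" "r (Suc j)" "\<theta> (Suc j)" "P j y"]
    by (simp add: P_def perm_prod_Suc)
  show ?case
  proof (intro conjI allI impI)
    fix l y assume l: "l < Suc j" "r l + \<theta> (Suc l) < y" "y \<le> r (Suc l) + \<theta> (Suc l)"
    show "P (Suc j) y = y - \<theta> (Suc l)"
    proof (cases "l = j")
      case True
      then show ?thesis using l r \<theta> IH(3)[of y] by (simp add: P)
    next
      case False
      then have "r (Suc l) \<le> r j"
        using l Suc.prems r_mono[of "Suc l" j] by simp
      then show ?thesis using False l IH(1)[of l y] by (simp add: P)
    qed
  next
    fix l y assume l: "l < Suc j" "r l + \<theta> l < y" "y \<le> r l + \<theta> (Suc l)"
    show "P (Suc j) y = y + (r (Suc j) - r l)"
    proof (cases "l = j")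
      case True
      then show ?thesis using l r IH(3)[of y] by (simp add: P)
    next
      case False
      then have "r l \<le> r j" "\<theta> (Suc l) \<le> \<theta> j"
        using l Suc.prems r_mono[of l j] \<theta>_mono[of "Suc l" j] by simp_all
      then show ?thesis using False l r \<theta> IH(2)[of l y] by (simp add: P)
    qed
  next
    fix y assume "r (Suc j) + \<theta> (Suc j) < y"
    then show "P (Suc j) y = y"
      using r \<theta> IH(3)[of y] by (simp add: P)
  next
    show "P (Suc j) 0 = 0" by (simp add: P IH(4))
  qed
qed

definition inverse_product :: "nat \<Rightarrow> nat"
  where "inverse_product =
    perm_prod (\<lambda>j. t (r (j - 1) + \<theta> j) ^^ r (j - 1) \<cdot> t (r j + \<theta> j) ^^ \<theta> j) 1 m"

lemma inverse_product_apply: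
  shows inverse_product_block:
      "\<lbrakk>l < m; r l + \<theta> (Suc l) < y; y \<le> r (Suc l) + \<theta> (Suc l)\<rbrakk> \<Longrightarrow>
        inverse_product y = y - \<theta> (Suc l)"
    and inverse_product_gap:
      "\<lbrakk>l < m; r l + \<theta> l < y; y \<le> r l + \<theta> (Suc l)\<rbrakk> \<Longrightarrow> inverse_product y = y + (r m - r l)"
    and inverse_product_above: "r m + \<theta> m < y \<Longrightarrow> inverse_product y = y"
    and inverse_product_0: "inverse_product 0 = 0"
  using inverse_prefix_apply[of m] unfolding inverse_product_def by auto

lemma staircase_cases:
  obtains (zero) "y = 0"
  | (block) l where "l < m" "r l + \<theta> (Suc l) < y" "y \<le> r (Suc l) + \<theta> (Suc l)"
  | (gap) l where "l < m" "r l + \<theta> l < y" "y \<le> r l + \<theta> (Suc l)"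
  | (above) "r m + \<theta> m < y"
proof (cases "y = 0 \<or> r m + \<theta> m < y")
  case True
  then show thesis using zero above by blast
next
  case False
  then obtain l where "l < m" "r l + \<theta> l < y" "y \<le> r (Suc l) + \<theta> (Suc l)"
    by (auto intro: mono_step_exists[of "\<lambda>l. r l + \<theta> l" y m] simp: r_0 \<theta>_0)
  then show thesis using block gap by (cases "y \<le> r l + \<theta> (Suc l)") auto
qed

theorem elementary_inverse_product: "elementary (inverse_product y) = y"
proof (cases y rule: staircase_cases)
  case zero
  then show ?thesis by (simp add: inverse_product_0 elementary_0)
next
  case (block l)
  then show ?thesis
    using elementary_block[of l "y - \<theta> (Suc l)"] by (simp add: inverse_product_block)
next
  case (gap l)
  then show ?thesis
    using elementary_gap[of l "y + (r m - r l)"] r_mono[of l m]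
    by (simp add: inverse_product_gap)
next
  case above
  then show ?thesis by (simp add: inverse_product_above elementary_above)
qed

section \<open>Descents\<close>

lemma elementary_increasing_below:
  assumes "0 < x" "x < r m"
  shows "elementary x < elementary (x + 1)"
proof -
  obtain l where l: "l < m" "r l < x" "x \<le> r (Suc l)"
    using mono_step_exists[of r x m] assms r_0 by auto
  obtain l' where l': "l' < m" "r l' < x + 1" "x + 1 \<le> r (Suc l')"
    using mono_step_exists[of r "x + 1" m] assms r_0 by auto
  have "l \<le> l'"
    using l l' r_mono[of "Suc l'" l] by (cases "l \<le> l'") auto
  then have "\<theta> (Suc l) \<le> \<theta> (Suc l')" using l' \<theta>_mono by simp
  then show ?thesis
    using l l' by (simp add: elementary_block)
qed

lemma elementary_increasing_above:
  assumes "r m < x"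
  shows "elementary x < elementary (x + 1)"
proof (cases "x \<le> r m + \<theta> m")
  case False
  then show ?thesis by (simp add: elementary_above)
next
  case True
  then obtain l where l: "l < m" "r m + \<theta> l < x" "x \<le> r m + \<theta> (Suc l)"
    using mono_step_exists[of "\<lambda>l. r m + \<theta> l" x m] assms \<theta>_0 by auto
  have x: "elementary x = x - (r m - r l)"
    using l by (rule elementary_gap)
  show ?thesis
  proof (cases "x + 1 \<le> r m + \<theta> m")
    case False
    then show ?thesis using x by (simp add: elementary_above)
  next
    case True
    then obtain l' where l': "l' < m" "r m + \<theta> l' < x + 1" "x + 1 \<le> r m + \<theta> (Suc l')"
      using mono_step_exists[of "\<lambda>l. r m + \<theta> l" "x + 1" m] assms \<theta>_0 by auto
    have "l \<le> l'"
      using l l' \<theta>_mono[of "Suc l'" l] by (cases "l \<le> l'") auto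
    then have "r l \<le> r l'" "r l' \<le> r m" using l' r_mono by simp_all
    then show ?thesis using x l l' by (simp add: elementary_gap)
  qed
qed

theorem des_elementary:
  assumes "0 < m" "0 < \<theta> m" "r m + \<theta> m \<le> n"
  shows "des n elementary = {r m}"
proof -
  have last: "elementary (r m) = r m + \<theta> m"
    using elementary_block[of "m - 1" "r m"] r_step[of "m - 1"] assms(1) by simp
  obtain l where l: "l < m" "r m + \<theta> l < r m + 1" "r m + 1 \<le> r m + \<theta> (Suc l)"
    using mono_step_exists[of "\<lambda>l. r m + \<theta> l" "r m + 1" m] assms(2) \<theta>_0 by auto
  have "elementary (r m + 1) = r l + 1"
    using l r_mono[of l m] elementary_gap[of l "r m + 1"] by simp
  then have "elementary (r m + 1) < elementary (r m)"
    using last assms(2) l r_less[of l m] by simp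
  moreover have "0 < r m" using r_less[of 0 m] assms(1) r_0 by simp
  ultimately have "r m \<in> des n elementary"
    using assms(2,3) by (simp add: des_def)
  moreover have "x = r m" if "x \<in> des n elementary" for x
    using that[unfolded des_def] elementary_increasing_below[of x] elementary_increasing_above[of x]
    by (cases x "r m" rule: linorder_cases) simp_all
  ultimately show ?thesis by blast
qed

text \<open>
  Blocks are sent below \<open>r m\<close> and gaps above it, both in increasing order, so only the passage
  from a gap to the block after it can be a descent.
\<close>
theorem des_inverse_product:
  assumes "r m + \<theta> m \<le> n"
  shows "des n inverse_product = {r l + \<theta> (Suc l) | l. l < m \<and> \<theta> l < \<theta> (Suc l)}"
proof (intro set_eqI iffI)
  fix y assume "y \<in> {r l + \<theta> (Suc l) | l. l < m \<and> \<theta> l < \<theta> (Suc l)}"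
  then obtain l where l: "l < m" "\<theta> l < \<theta> (Suc l)" "y = r l + \<theta> (Suc l)" by blast
  have "r l < r (Suc l)" "r (Suc l) \<le> r m" "\<theta> (Suc l) \<le> \<theta> m"
    using l r_step r_mono[of "Suc l" m] \<theta>_mono[of "Suc l" m] by simp_all
  then show "y \<in> des n inverse_product"
    using l assms inverse_product_gap[of l y] inverse_product_block[of l "y + 1"]
    by (simp add: des_def)
next
  fix y assume "y \<in> des n inverse_product"
  then have y: "0 < y" "inverse_product y > inverse_product (y + 1)"
    by (simp_all add: des_def)
  have mono: "r a + \<theta> a \<le> r b + \<theta> b" if "a \<le> b" "b \<le> m" for a b
    using that by (intro add_mono r_mono \<theta>_mono)
  show "y \<in> {r l + \<theta> (Suc l) | l. l < m \<and> \<theta> l < \<theta> (Suc l)}"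
  proof (cases y rule: staircase_cases)
    case zero
    then show ?thesis using y by simp
  next
    case above
    then show ?thesis using y by (simp add: inverse_product_above)
  next
    case (block l)
    have y_eq: "inverse_product y = y - \<theta> (Suc l)"
      using block by (rule inverse_product_block)
    \<comment> \<open>Everything behind a point of a block is sent to a larger value.\<close>
    have "inverse_product y < inverse_product (y + 1)"
    proof (cases "y + 1" rule: staircase_cases)
      case zero
      then show ?thesis by simp
    next
      case above
      then show ?thesis using y_eq by (simp add: inverse_product_above)
    next
      case (gap l')
      then show ?thesis using y_eq inverse_product_gap[OF gap] by simp
    next
      case block': (block l')
      have "\<not> l' < l"
        using block block' mono[of "Suc l'" l] \<theta>_step[of l] by auto
      moreover have "r (Suc l) \<le> r l'" if "l < l'"
        using that block' r_mono[of "Suc l" l'] by simp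
      ultimately show ?thesis
        using y_eq block block' inverse_product_block[OF block']
        by (cases "l = l'") auto
    qed
    then show ?thesis using y by simp
  next
    case (gap l)
    have y_eq: "inverse_product y = y + (r m - r l)"
      using gap by (rule inverse_product_gap)
    have bounds: "r l \<le> r m" "\<theta> (Suc l) \<le> \<theta> m"
      using gap r_mono[of l m] \<theta>_mono[of "Suc l" m] by simp_all
    show ?thesis
    proof (cases "y + 1" rule: staircase_cases)
      case zero
      then show ?thesis by simp
    next
      case above
      then have "inverse_product y < inverse_product (y + 1)"
        using y_eq gap bounds by (simp add: inverse_product_above)
      then show ?thesis using y by simp
    next
      case gap': (gap l')
      have "\<not> l' < l"
        using gap gap' mono[of "Suc l'" l] r_step[of l'] by auto
      moreover have "\<not> l < l'"
        using gap gap' mono[of "Suc l" l'] r_step[of l] by auto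
      ultimately have "l = l'" by simp
      then have "inverse_product y < inverse_product (y + 1)"
        using y_eq inverse_product_gap[OF gap'] by simp
      then show ?thesis using y by simp
    next
      case block: (block l')
      have "\<not> l' < l"
        using gap block mono[of "Suc l'" l] by auto
      moreover have "\<not> l < l'"
        using gap block mono[of "Suc l" l'] \<theta>_step[of l'] r_step[of l] by auto
      ultimately have "l = l'" by simp
      then have "y = r l + \<theta> (Suc l)" using gap block by simp
      then show ?thesis using gap by auto
    qed
  qed
qed

end

section \<open>Elementary elements and their inverses\<close>

theorem theorem3p34:
  fixes n m :: nat and k i \<pi> :: "nat \<Rightarrow> nat"
  assumes "\<pi> permutes {1..n}"
    and "1 \<le> m"
    and "OGS_elementary n m k i"
    and "\<pi> = perm_prod (\<lambda>j. t (k j) ^^ i (k j)) 1 m"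
  shows "maj n \<pi> = OGS_rho m k i 1 \<and> maj n \<pi> \<le> k 1 \<and>
    (\<forall>j\<in>{1..m}. kappa_minus m k i j = k j - OGS_rho m k i j \<and>
                kappa_plus m k i j = k j - OGS_rho m k i (j + 1)) \<and>
    inv \<pi> = t (kappa_plus m k i 1) ^^ OGS_vartheta m k i 1 \<cdot>
      perm_prod (\<lambda>j. t (kappa_minus m k i j) ^^ OGS_varrho k i (j - 1) \<cdot>
                     t (kappa_plus m k i j) ^^ OGS_vartheta m k i j) 2 m \<and>
    (k 1 = maj n \<pi> \<longrightarrow>
      kappa_minus m k i 1 = 0 \<and> OGS_vartheta m k i 1 = 0 \<and>
      inv \<pi> = perm_prod (\<lambda>j. t (kappa_minus m k i j) ^^ OGS_varrho k i (j - 1) \<cdot>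
                              t (kappa_plus m k i j) ^^ OGS_vartheta m k i j) 2 m) \<and>
    (k 1 > maj n \<pi> \<longrightarrow> des n (inv \<pi>) = {kappa_minus m k i j | j. 1 \<le> j \<and> j \<le> m}) \<and>
    (k 1 = maj n \<pi> \<longrightarrow> des n (inv \<pi>) = {kappa_minus m k i j | j. 2 \<le> j \<and> j \<le> m})"
proof -
  define r where "r = OGS_varrho k i"
  define \<theta> where "\<theta> j = (if j = 0 then 0 else OGS_vartheta m k i j)" for j
  have k_mono: "k a < k b" if "1 \<le> a" "a < b" "b \<le> m" for a b
    using assms(3) that strict_mono_onD[of "{1..m}" k a b]
    by (simp add: OGS_elementary_def OGS_canonical_def)
  have k_i: "k j \<le> n" "0 < i (k j)" "i (k j) < k j" if "1 \<le> j" "j \<le> m" for j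
    using assms(3) that unfolding OGS_elementary_def OGS_canonical_def by auto
  have rm: "OGS_rho m k i 1 = r m"
    by (simp add: r_def OGS_rho_def OGS_varrho_def)
  have rm_le_k1: "r m \<le> k 1"
    using assms(3) by (simp add: r_def OGS_varrho_def OGS_elementary_def)
  have k_eq: "k j = r m + \<theta> j" if "1 \<le> j" "j \<le> m" for j
    using that rm rm_le_k1 k_mono[of 1 j]
    by (cases "j = 1") (auto simp: \<theta>_def OGS_vartheta_def)
  have r_Suc: "r (Suc j) = r j + i (k (Suc j))" for j
    by (simp add: r_def OGS_varrho_def)
  have \<theta>_less: "\<theta> a < \<theta> b" if "1 \<le> a" "a < b" "b \<le> m" for a b
    using k_mono[of a b] k_eq[of a] k_eq[of b] that by simp
  interpret staircase m r \<theta>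
  proof
    show "r 0 = 0" by (simp add: r_def OGS_varrho_def)
    show "\<theta> 0 = 0" by (simp add: \<theta>_def)
    show "r l < r (Suc l)" if "l < m" for l
      using that k_i(2)[of "Suc l"] by (simp add: r_Suc)
    show "\<theta> l \<le> \<theta> (Suc l)" if "l < m" for l
      using that \<theta>_less[of l "Suc l"] \<open>\<theta> 0 = 0\<close> by (cases "l = 0") auto
  qed

  have i_eq: "i (k j) = r j - r (j - 1)" if "1 \<le> j" for j
    using that r_Suc[of "j - 1"] by simp
  have \<pi>_eq: "\<pi> = elementary"
    unfolding assms(4) elementary_def
    by (rule perm_prod_cong) (simp add: k_eq[symmetric] i_eq)

  have minus: "kappa_minus m k i j = r (j - 1) + \<theta> j"
    and plus: "kappa_plus m k i j = r j + \<theta> j" if "1 \<le> j" for j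
    using that by (simp_all add: kappa_minus_def kappa_plus_def r_def \<theta>_def)
  have rho: "r (j - 1) + OGS_rho m k i j = r m" if "1 \<le> j" "j \<le> Suc m" for j
  proof -
    have "{1..m} = {1..j - 1} \<union> {j..m}" "{1..j - 1} \<inter> {j..m} = {}"
      using that by auto
    then show ?thesis
      by (simp add: r_def OGS_rho_def OGS_varrho_def sum.union_disjoint)
  qed
  have kappa: "kappa_minus m k i j = k j - OGS_rho m k i j \<and>
      kappa_plus m k i j = k j - OGS_rho m k i (j + 1)" if "j \<in> {1..m}" for j
  proof -
    have "kappa_minus m k i j + OGS_rho m k i j = k j"
      using that rho[of j] k_eq[of j] minus[of j] by simp
    moreover have "kappa_plus m k i j + OGS_rho m k i (j + 1) = k j"
      using that rho[of "j + 1"] k_eq[of j] plus[of j] by simp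
    ultimately show ?thesis by (metis add_diff_cancel_right')
  qed

  \<comment> \<open>For a single factor this is the condition on its exponent; otherwise \<open>k 1 < k m\<close>.\<close>
  have \<theta>m: "0 < \<theta> m"
  proof (cases "m = 1")
    case True
    then show ?thesis using k_i(3)[of 1] k_eq[of 1] r_Suc[of 0] r_0 by simp
  next
    case False
    then show ?thesis using assms(2) \<theta>_less[of 1 m] by simp
  qed
  have top: "r m + \<theta> m \<le> n" using k_eq[of m] k_i(1)[of m] assms(2) by simp
  have maj: "maj n \<pi> = r m"
    using des_elementary[OF _ \<theta>m top] assms(2) by (simp add: maj_def \<pi>_eq)

  define F where "F j = t (kappa_minus m k i j) ^^ OGS_varrho k i (j - 1) \<cdot>
    t (kappa_plus m k i j) ^^ OGS_vartheta m k i j" for j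
  have "inj \<pi>" using assms(1) by (rule permutes_inj)
  have "inv \<pi> y = inverse_product y" for y
    using inv_f_f[OF \<open>inj \<pi>\<close>, of "inverse_product y"]
    by (simp add: \<pi>_eq elementary_inverse_product)
  then have inv: "inv \<pi> = inverse_product" by blast
  have "inv \<pi> = perm_prod F 1 m"
    unfolding inv inverse_product_def F_def
    by (rule perm_prod_cong) (simp add: minus plus r_def[symmetric] \<theta>_def)
  also have "\<dots> = F 1 \<cdot> perm_prod F 2 m"
    using assms(2) perm_prod_first[of 1 m F] by (simp add: numeral_2_eq_2)
  also have "F 1 = t (kappa_plus m k i 1) ^^ OGS_vartheta m k i 1"
    using r_0 by (simp add: F_def r_def[symmetric] id_def[symmetric])
  finally have inv_formula:
    "inv \<pi> = t (kappa_plus m k i 1) ^^ OGS_vartheta m k i 1 \<cdot> perm_prod F 2 m" .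

  have \<theta>1: "OGS_vartheta m k i 1 = \<theta> 1" "k 1 = r m + \<theta> 1"
    using k_eq[of 1] assms(2) by (simp_all add: \<theta>_def)
  have "des n (inv \<pi>) = {r l + \<theta> (Suc l) | l. l < m \<and> \<theta> l < \<theta> (Suc l)}"
    using des_inverse_product[OF top] by (simp add: inv)
  also have "\<dots> = {kappa_minus m k i j | j. 1 \<le> j \<and> j \<le> m \<and> \<theta> (j - 1) < \<theta> j}"
  proof (intro set_eqI iffI)
    fix y assume "y \<in> {r l + \<theta> (Suc l) | l. l < m \<and> \<theta> l < \<theta> (Suc l)}"
    then obtain l where "l < m" "\<theta> l < \<theta> (Suc l)" "y = r l + \<theta> (Suc l)" by blast
    then show "y \<in> {kappa_minus m k i j | j. 1 \<le> j \<and> j \<le> m \<and> \<theta> (j - 1) < \<theta> j}"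
      using minus[of "Suc l"] by (auto intro!: exI[of _ "Suc l"])
  next
    fix y assume "y \<in> {kappa_minus m k i j | j. 1 \<le> j \<and> j \<le> m \<and> \<theta> (j - 1) < \<theta> j}"
    then obtain j where "1 \<le> j" "j \<le> m" "\<theta> (j - 1) < \<theta> j" "y = r (j - 1) + \<theta> j"
      using minus by auto
    then show "y \<in> {r l + \<theta> (Suc l) | l. l < m \<and> \<theta> l < \<theta> (Suc l)}"
      by (auto intro!: exI[of _ "j - 1"])
  qed
  finally have des: "des n (inv \<pi>) =
    {kappa_minus m k i j | j. 1 \<le> j \<and> j \<le> m \<and> \<theta> (j - 1) < \<theta> j}" .
  have \<theta>_iff: "\<theta> (j - 1) < \<theta> j \<longleftrightarrow> j \<noteq> 1 \<or> 0 < \<theta> 1" if "1 \<le> j" "j \<le> m" for j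
    using that \<theta>_less[of "j - 1" j] \<theta>_0 by (cases "j = 1") auto

  have des_gt: "des n (inv \<pi>) = {kappa_minus m k i j | j. 1 \<le> j \<and> j \<le> m}" if "0 < \<theta> 1"
    unfolding des using that \<theta>_iff by blast
  have des_eq: "des n (inv \<pi>) = {kappa_minus m k i j | j. 2 \<le> j \<and> j \<le> m}" if "\<theta> 1 = 0"
  proof -
    have "1 \<le> j \<and> j \<le> m \<and> \<theta> (j - 1) < \<theta> j \<longleftrightarrow> 2 \<le> j \<and> j \<le> m" for j
      using that \<theta>_iff[of j] by auto
    then show ?thesis unfolding des by simp
  qed
  have inv_eq: "inv \<pi> = perm_prod F 2 m" if "\<theta> 1 = 0"
    using inv_formula that \<theta>1(1) by (simp add: id_def[symmetric])

  have F: "F = (\<lambda>j. t (kappa_minus m k i j) ^^ OGS_varrho k i (j - 1) \<cdot>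
      t (kappa_plus m k i j) ^^ OGS_vartheta m k i j)"
    by (simp add: F_def fun_eq_iff)
  show ?thesis
  proof (intro conjI impI ballI)
    show "inv \<pi> = perm_prod (\<lambda>j. t (kappa_minus m k i j) ^^ OGS_varrho k i (j - 1) \<cdot>
        t (kappa_plus m k i j) ^^ OGS_vartheta m k i j) 2 m" if "k 1 = maj n \<pi>"
      using that inv_eq maj \<theta>1(2) unfolding F by simp
  next
    show "des n (inv \<pi>) = {kappa_minus m k i j | j. 1 \<le> j \<and> j \<le> m}" if "maj n \<pi> < k 1"
      using that maj \<theta>1(2) by (intro des_gt) simp
  next
    show "des n (inv \<pi>) = {kappa_minus m k i j | j. 2 \<le> j \<and> j \<le> m}" if "k 1 = maj n \<pi>"
      using that maj \<theta>1(2) by (intro des_eq) simp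
  qed (use maj rm rm_le_k1 kappa inv_formula[unfolded F] \<theta>1 minus[of 1] r_0 in simp_all)
qed

end
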